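(* Let $n>0$ be an integer, and let $\{\xi_k\}_{k\ge0}$ be a sequence of positive real numbers. Suppose that there exist $k_0>0$ and real numbers $A_1,A_2>0$, $\alpha>\beta>0$ and $\epsilon>0$ such that $$\xi_1\le\exp\Big(-\alpha\sum_{i=1}^n\frac1{k_0+i}\Big)\xi_0+A_1$$ and $$\xi_{k+1}\le\exp\Big(-\alpha\sum_{i=1}^n\frac1{k_0+nk+i}+\frac{\epsilon}{k^2}\Big)\xi_k+\frac{A_2}{(k_0+n(k+1))^{\beta+1}}\qquad\text{for any }k\ge1.$$ Then, for any $K\ge1$, with $c:=e^{\epsilon\pi^2/6}$, $$\xi_K\le\frac{c\,(k_0+1)^\alpha\,\xi_0}{(k_0+nK)^\alpha}+\frac{c\,(k_0+n+1)^\alpha A_1}{(k_0+nK)^\alpha}+\frac{\frac{c}{\alpha-\beta}\,e^{\frac{\alpha}{k_0+n+1}}A_2}{n\,(k_0+nK)^\beta}+\frac{c\,e^{\frac{\alpha}{k_0+n+1}}A_2}{(k_0+nK)^{\beta+1}}.$$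
   Context: $k_0$ is a positive real number; $k$ and $K$ range over integers. *)

theory Defs
  imports Complex_Main
begin

end

theory Submission
  imports Defs "HOL-Analysis.Gamma_Function"
begin

text \<open>
  Write \<open>x\<^sub>k = k0 + n k\<close>. Comparing the harmonic sum with a logarithm, the factor
  \<open>exp (- \<alpha> \<Sum>i. 1 / (x\<^sub>k + i))\<close> is at most \<open>((x\<^sub>k + 1) / (x\<^sub>k\<^sub>+\<^sub>1 + 1)) powr \<alpha>\<close>, which telescopes.
  Unrolling the recursion thus bounds \<open>(x\<^sub>K + 1) powr \<alpha> * \<xi> K\<close> by the initial
  contributions plus a multiple of \<open>\<Sum>k=2..K. x\<^sub>k powr (\<alpha> - \<beta> - 1)\<close>, up to the factor
  \<open>exp (\<epsilon> \<Sum>j<K. 1 / j\<^sup>2) \<le> c\<close>. The last sum is compared with the integral of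
  \<open>t powr (\<alpha> - \<beta> - 1)\<close>.
\<close>

text \<open>Induction on \<open>n\<close>, each step being \<open>ln (1 + 1 / y) \<le> 1 / y\<close>
  at \<open>y = x + n + 1\<close>. A lower bound on the sum compares \<open>1 / (x + i)\<close> with
  the integral of \<open>1 / t\<close> from \<open>x + i\<close> to \<open>x + i + 1\<close>; this
  is where the shift by one in the quotient comes from.\<close>

lemma ln_quotient_le_harmonic_sum:
  fixes x :: real
  assumes "x \<ge> 0"
  shows "ln ((x + real n + 1) / (x + 1)) \<le> (\<Sum>i=1..n. 1 / (x + real i))"
proof (induction n)
  case 0
  then show ?case using assms by simp
next
  case (Suc n)
  define y where "y = x + real n + 1"
  have y: "y > 0" using assms by (simp add: y_def)
  have "ln (1 + 1 / y) \<le> 1 / y"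
    using y by (intro ln_add_one_self_le_self) auto
  moreover have "1 + 1 / y = (y + 1) / y"
    using y by (simp add: field_simps)
  ultimately have "ln (y + 1) - ln y \<le> 1 / y"
    using y by (simp add: ln_div)
  moreover have "ln y - ln (x + 1) \<le> (\<Sum>i=1..n. 1 / (x + real i))"
    using Suc y assms by (simp add: ln_div y_def)
  moreover have "ln ((x + real (Suc n) + 1) / (x + 1)) = ln (y + 1) - ln (x + 1)"
    using y assms by (simp add: ln_div y_def add_ac)
  ultimately show ?case
    by (simp add: y_def add_ac)
qed

lemma exp_harmonic_sum_le_powr:
  fixes x \<alpha> :: real
  assumes "x \<ge> 0" "\<alpha> \<ge> 0"
  shows "exp (- \<alpha> * (\<Sum>i=1..n. 1 / (x + real i)))
           \<le> (x + 1) powr \<alpha> / (x + real n + 1) powr \<alpha>"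
proof -
  have "exp (- \<alpha> * (\<Sum>i=1..n. 1 / (x + real i)))
          \<le> exp (- (\<alpha> * ln ((x + real n + 1) / (x + 1))))"
    using mult_left_mono[OF ln_quotient_le_harmonic_sum[OF assms(1), of n] assms(2)] by simp
  also have "\<dots> = (x + 1) powr \<alpha> / (x + real n + 1) powr \<alpha>"
    using assms by (simp add: powr_def ln_div right_diff_distrib flip: exp_diff)
  finally show ?thesis .
qed

text \<open>This is \<open>ln (1 + 1 / x) \<le> 1 / x\<close>, multiplied by \<alpha> and
  exponentiated. It is the price of trading the telescoping weight at \<open>x + 1\<close> for a
  pure power of \<open>x\<close> in the noise terms.\<close>

lemma powr_add_one_le:
  fixes x \<alpha> :: real
  assumes "x > 0" "\<alpha> \<ge> 0"
  shows "(x + 1) powr \<alpha> \<le> exp (\<alpha> / x) * x powr \<alpha>"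
proof -
  have "ln (1 + 1 / x) \<le> 1 / x"
    using assms by (intro ln_add_one_self_le_self) auto
  moreover have "1 + 1 / x = (x + 1) / x"
    using assms by (simp add: field_simps)
  ultimately have "ln (x + 1) \<le> 1 / x + ln x"
    using assms by (simp add: ln_div)
  from mult_left_mono[OF this assms(2)] show ?thesis
    using assms by (simp add: powr_def distrib_left flip: exp_add)
qed

text \<open>Stands in for the integral of \<open>t powr (\<delta> - 1)\<close>: the power at the
  intermediate point \<open>z\<close> can be compared with the power at either endpoint, according
  to the sign of \<open>\<delta> - 1\<close>.\<close>

lemma powr_diff_mvt:
  fixes x y \<delta> :: real
  assumes "0 < x" "x < y"
  obtains z where "x < z" "z < y" "y powr \<delta> - x powr \<delta> = (y - x) * (\<delta> * z powr (\<delta> - 1))"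
proof -
  have "((\<lambda>t. t powr \<delta>) has_real_derivative \<delta> * t powr (\<delta> - 1)) (at t)" if "x \<le> t" for t
    using that assms by (intro has_real_derivative_powr) auto
  from MVT2[OF assms(2), OF this] that show ?thesis by blast
qed

text \<open>
  The summand \<open>x\<^sub>K powr (\<delta> - 1)\<close> has to be kept outside the integral only when
  \<open>t powr (\<delta> - 1)\<close> is increasing.
\<close>

lemma sum_powr_arith_progression_le:
  fixes a h \<delta> :: real
  assumes "a > 0" "h > 0" "\<delta> > 0" "K \<ge> 1"
  shows "(\<Sum>j\<in>{1..<K}. (a + h * (real j + 1)) powr (\<delta> - 1))
           \<le> (a + h * real K) powr \<delta> / (h * \<delta>) + (a + h * real K) powr (\<delta> - 1)"
proof -
  let ?x = "\<lambda>k. a + h * real k"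
  have pos: "?x k > 0" for k
    using assms by (simp add: add_pos_nonneg)
  have step: "?x k < ?x (Suc k)" and gap: "?x (Suc k) - ?x k = h" for k
    using assms by (simp_all add: algebra_simps)
  show ?thesis
  proof (cases "\<delta> \<ge> 1")
    case True
    have "(\<Sum>j\<in>{1..<K}. ?x (Suc j) powr (\<delta> - 1))
            \<le> ?x K powr \<delta> / (h * \<delta>) + ?x K powr (\<delta> - 1)"
      using \<open>K \<ge> 1\<close>
    proof (induction K rule: dec_induct)
      case base
      then show ?case using assms by (simp add: less_imp_le)
    next
      case (step k)
      obtain z where z: "?x k < z" "?x (Suc k) powr \<delta> - ?x k powr \<delta> = h * (\<delta> * z powr (\<delta> - 1))"
        using powr_diff_mvt[OF pos \<open>?x k < ?x (Suc k)\<close>, of \<delta>] unfolding gap by metis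
      \<comment> \<open>The extra term of the induction hypothesis is absorbed by the growth of the
        integral part, and the new summand takes its place as the extra term.\<close>
      have "?x k powr (\<delta> - 1) \<le> z powr (\<delta> - 1)"
        using True z(1) pos[of k] by (intro powr_mono2) auto
      also have "\<dots> = ?x (Suc k) powr \<delta> / (h * \<delta>) - ?x k powr \<delta> / (h * \<delta>)"
        unfolding diff_divide_distrib[symmetric] z(2) using assms by simp
      finally show ?case using step by simp
    qed
    then show ?thesis by (simp add: add_ac)
  next
    case False
    have "(\<Sum>j\<in>{1..<K}. ?x (Suc j) powr (\<delta> - 1)) \<le> ?x K powr \<delta> / (h * \<delta>)"
      using \<open>K \<ge> 1\<close>
    proof (induction K rule: dec_induct)
      case base
      then show ?case using assms by simp
    next
      case (step k)
      obtain z where z: "?x k < z" "z < ?x (Suc k)"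
        "?x (Suc k) powr \<delta> - ?x k powr \<delta> = h * (\<delta> * z powr (\<delta> - 1))"
        using powr_diff_mvt[OF pos \<open>?x k < ?x (Suc k)\<close>, of \<delta>] unfolding gap by metis
      \<comment> \<open>The power is now decreasing, so the growth of the integral part absorbs the
        new summand itself.\<close>
      have "?x (Suc k) powr (\<delta> - 1) \<le> z powr (\<delta> - 1)"
        using False z(1,2) pos[of k] by (intro powr_mono2') auto
      also have "\<dots> = ?x (Suc k) powr \<delta> / (h * \<delta>) - ?x k powr \<delta> / (h * \<delta>)"
        unfolding diff_divide_distrib[symmetric] z(3) using assms by simp
      finally show ?case using step by simp
    qed
    then have "(\<Sum>j\<in>{1..<K}. ?x (Suc j) powr (\<delta> - 1))
        \<le> ?x K powr \<delta> / (h * \<delta>) + ?x K powr (\<delta> - 1)"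
      by (rule add_increasing2[rotated]) simp
    then show ?thesis by (simp add: add_ac)
  qed
qed

text \<open>A partial sum of the Basel series, reindexed to start at 0; it is the source of the
  exponent in \<open>c\<close>.\<close>

lemma sum_inverse_squares_le: "(\<Sum>j\<in>{1..<K}. 1 / (real j)\<^sup>2) \<le> pi\<^sup>2 / 6"
proof -
  have "(\<Sum>j\<in>{1..<K}. 1 / (real j)\<^sup>2) = (\<Sum>j<K - 1. 1 / (real (Suc j))\<^sup>2)"
    by (rule sum.reindex_bij_witness[of _ Suc "\<lambda>j. j - 1"]) auto
  also have "\<dots> \<le> (\<Sum>j. 1 / (real (Suc j))\<^sup>2)"
    using inverse_squares_sums by (intro sum_le_suminf) (auto simp: sums_iff add_ac)
  also have "\<dots> = pi\<^sup>2 / 6"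
    using inverse_squares_sums by (simp add: sums_iff add_ac)
  finally show ?thesis .
qed

theorem lemma12:
  fixes n :: nat and \<xi> :: "nat \<Rightarrow> real"
    and k0 A1 A2 \<alpha> \<beta> \<epsilon> c :: real
  assumes "n > 0"
    and "\<And>k. \<xi> k > 0"
    and "k0 > 0" and "A1 > 0" and "A2 > 0"
    and "\<alpha> > \<beta>" and "\<beta> > 0" and "\<epsilon> > 0"
    and "\<xi> 1 \<le> exp (- \<alpha> * (\<Sum>i=1..n. 1 / (k0 + real i))) * \<xi> 0 + A1"
    and "\<And>k. k \<ge> 1 \<Longrightarrow>
           \<xi> (k + 1) \<le> exp (- \<alpha> * (\<Sum>i=1..n. 1 / (k0 + real n * real k + real i))
                           + \<epsilon> / (real k)\<^sup>2) * \<xi> k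
                     + A2 / (k0 + real n * (real k + 1)) powr (\<beta> + 1)"
    and "c = exp (\<epsilon> * pi\<^sup>2 / 6)"
  shows "\<forall>K\<ge>1. \<xi> K \<le>
             c * (k0 + 1) powr \<alpha> * \<xi> 0 / (k0 + real n * real K) powr \<alpha>
           + c * (k0 + real n + 1) powr \<alpha> * A1 / (k0 + real n * real K) powr \<alpha>
           + (c / (\<alpha> - \<beta>)) * exp (\<alpha> / (k0 + real n + 1)) * A2
               / (real n * (k0 + real n * real K) powr \<beta>)
           + c * exp (\<alpha> / (k0 + real n + 1)) * A2 / (k0 + real n * real K) powr (\<beta> + 1)"
proof (intro allI impI)
  fix K :: nat
  assume "K \<ge> 1"
  define x where "x k = k0 + real n * real k" for k
  define M where "M = exp (\<alpha> / (k0 + real n + 1))"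
  \<comment> \<open>Both \<open>S\<close> and \<open>E\<close> are empty at index 1, since the first
    step of the recursion has neither a perturbation \<epsilon> nor a term in \<open>A2\<close>. In
    \<open>B\<close>, the error \<open>A1\<close> enters at index 1 and so carries the weight of
    \<open>x 1 + 1 = k0 + n + 1\<close>.\<close>
  define S where "S k = (\<Sum>j\<in>{1..<k}. x (Suc j) powr (\<alpha> - \<beta> - 1))" for k
  define E where "E k = exp (\<epsilon> * (\<Sum>j\<in>{1..<k}. 1 / (real j)\<^sup>2))" for k
  define B where "B = (k0 + 1) powr \<alpha> * \<xi> 0 + (k0 + real n + 1) powr \<alpha> * A1"
  note pos = assms(3-5,7,8) assms(2)[of 0]
  have \<alpha>: "\<alpha> > 0" using assms by simp
  have x_pos: "x k > 0" for k
    using assms by (simp add: x_def add_pos_nonneg)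
  have x_Suc: "x k + real n = x (Suc k)" for k
    by (simp add: x_def algebra_simps)
  have M: "M > 0" by (simp add: M_def)
  have S: "S k \<ge> 0" for k by (simp add: S_def sum_nonneg)
  have E1: "E k \<ge> 1" for k
    using pos by (simp add: E_def sum_nonneg)
  have E_Suc: "E (Suc k) = exp (\<epsilon> / (real k)\<^sup>2) * E k" if "k \<ge> 1" for k
    using that by (simp add: E_def distrib_left mult_exp_exp add_ac)
  have B: "B > 0" using pos by (auto simp: B_def intro!: add_pos_pos mult_pos_pos)

  have noise: "A2 / x (Suc k) powr (\<beta> + 1)
      \<le> M * A2 * x (Suc k) powr (\<alpha> - \<beta> - 1) / (x (Suc k) + 1) powr \<alpha>" if "k \<ge> 1" for k
  proof -
    let ?y = "x (Suc k)"
    \<comment> \<open>Noise first enters at \<open>x 2 = k0 + 2 * n\<close>, which is at least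
      \<open>k0 + n + 1\<close>; hence the single constant \<open>M\<close> serves every
      step.\<close>
    have "real n * 1 + 1 \<le> real n * real k + real n"
      using that \<open>n > 0\<close> by (intro add_mono mult_left_mono) auto
    then have "k0 + real n + 1 \<le> ?y"
      by (simp add: x_def algebra_simps)
    then have "\<alpha> / ?y \<le> \<alpha> / (k0 + real n + 1)"
      using \<alpha> pos by (intro divide_left_mono) auto
    then have "exp (\<alpha> / ?y) * ?y powr \<alpha> \<le> M * ?y powr \<alpha>"
      unfolding M_def by (intro mult_right_mono) auto
    then have "(?y + 1) powr \<alpha> \<le> M * ?y powr \<alpha>"
      using powr_add_one_le[OF x_pos[of "Suc k"], of \<alpha>] \<alpha> by linarith
    then have "A2 * (?y + 1) powr \<alpha> / ?y powr (\<beta> + 1) \<le> A2 * (M * ?y powr \<alpha>) / ?y powr (\<beta> + 1)"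
      using pos by (intro divide_right_mono mult_left_mono) auto
    also have "\<dots> = M * A2 * ?y powr (\<alpha> - \<beta> - 1)"
      using powr_diff[of ?y \<alpha> "\<beta> + 1"] by (simp add: diff_diff_eq)
    finally show ?thesis
      using x_pos[of "Suc k"] by (simp add: field_simps)
  qed

  have main: "\<xi> K \<le> E K * (B + M * A2 * S K) / (x K + 1) powr \<alpha>"
    using \<open>K \<ge> 1\<close>
  proof (induction K rule: dec_induct)
    case base
    have "\<xi> 1 \<le> (k0 + 1) powr \<alpha> / (k0 + real n + 1) powr \<alpha> * \<xi> 0 + A1"
      using assms(9) mult_right_mono[OF exp_harmonic_sum_le_powr[of k0 \<alpha> n], of "\<xi> 0"] pos \<alpha>
      by linarith
    also have "\<dots> = E 1 * (B + M * A2 * S 1) / (x 1 + 1) powr \<alpha>"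
      using pos by (simp add: E_def S_def B_def x_def field_simps)
    finally show ?case .
  next
    case (step k)
    let ?w = "\<lambda>k. (x k + 1) powr \<alpha>"
    have w: "?w k > 0" for k using x_pos[of k] by simp
    have "exp (- \<alpha> * (\<Sum>i=1..n. 1 / (x k + real i))) \<le> ?w k / ?w (Suc k)"
      using exp_harmonic_sum_le_powr[of "x k" \<alpha> n] x_pos[of k] \<alpha> by (simp add: x_Suc)
    then have "exp (- \<alpha> * (\<Sum>i=1..n. 1 / (x k + real i)) + \<epsilon> / (real k)\<^sup>2) * \<xi> k
        \<le> ?w k / ?w (Suc k) * exp (\<epsilon> / (real k)\<^sup>2) * (E k * (B + M * A2 * S k) / ?w k)"
      unfolding exp_add using step.IH assms(2)[of k]
      by (intro mult_mono) auto
    also have "\<dots> = E (Suc k) * (B + M * A2 * S k) / ?w (Suc k)"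
      using w[of k] step.hyps by (simp add: E_Suc)
    finally have "exp (- \<alpha> * (\<Sum>i=1..n. 1 / (x k + real i)) + \<epsilon> / (real k)\<^sup>2) * \<xi> k
        \<le> E (Suc k) * (B + M * A2 * S k) / ?w (Suc k)" .
    moreover have "\<xi> (Suc k) \<le> exp (- \<alpha> * (\<Sum>i=1..n. 1 / (x k + real i)) + \<epsilon> / (real k)\<^sup>2) * \<xi> k
        + A2 / x (Suc k) powr (\<beta> + 1)"
      using assms(10)[OF step.hyps(1)] by (simp add: x_def add_ac)
    \<comment> \<open>The fresh noise has not been multiplied by any perturbation factor. Inserting
      \<open>E (Suc k) \<ge> 1\<close> makes \<open>E (Suc k)\<close> a common factor, which keeps
      the invariant in product form.\<close>
    moreover have "M * A2 * x (Suc k) powr (\<alpha> - \<beta> - 1) / ?w (Suc k)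
        \<le> E (Suc k) * (M * A2 * x (Suc k) powr (\<alpha> - \<beta> - 1)) / ?w (Suc k)"
      using mult_right_mono[OF E1[of "Suc k"], of "M * A2 * x (Suc k) powr (\<alpha> - \<beta> - 1)"] M pos
      by (intro divide_right_mono) auto
    ultimately have "\<xi> (Suc k) \<le> E (Suc k) * (B + M * A2 * S k) / ?w (Suc k)
        + E (Suc k) * (M * A2 * x (Suc k) powr (\<alpha> - \<beta> - 1)) / ?w (Suc k)"
      using noise[OF step.hyps(1)] by linarith
    also have "\<dots> = E (Suc k) * (B + M * A2 * S (Suc k)) / ?w (Suc k)"
      using step.hyps by (simp add: S_def distrib_left add_divide_distrib)
    finally show ?case .
  qed

  have S_le: "S K \<le> x K powr (\<alpha> - \<beta>) / (real n * (\<alpha> - \<beta>)) + x K powr (\<alpha> - \<beta> - 1)"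
    using sum_powr_arith_progression_le[of k0 "real n" "\<alpha> - \<beta>" K] assms \<open>K \<ge> 1\<close>
    by (simp add: S_def x_def add_ac)
  have E_le: "E K \<le> c"
    using mult_left_mono[OF sum_inverse_squares_le[of K], of \<epsilon>] pos by (simp add: E_def assms(11))
  \<comment> \<open>Besides bounding \<open>E K\<close> and \<open>S K\<close>, this lowers the
    denominator from \<open>x K + 1\<close> to \<open>x K\<close>, so that the powers of
    \<open>x K\<close> combine into the exponents \<beta> and \<open>\<beta> + 1\<close> of the
    claim.\<close>
  have "E K * (B + M * A2 * S K) / (x K + 1) powr \<alpha>
      \<le> c * (B + M * A2 * (x K powr (\<alpha> - \<beta>) / (real n * (\<alpha> - \<beta>)) + x K powr (\<alpha> - \<beta> - 1)))
          / x K powr \<alpha>"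
    using E_le S_le S[of K] E1[of K] B M pos x_pos[of K] \<alpha>
    by (intro frac_le mult_mono add_mono powr_mono2) (auto intro!: add_nonneg_nonneg mult_nonneg_nonneg)
  also have "\<dots> = c * B / x K powr \<alpha>
      + c * M * A2 * (x K powr (\<alpha> - \<beta>) / x K powr \<alpha>) / (real n * (\<alpha> - \<beta>))
      + c * M * A2 * (x K powr (\<alpha> - \<beta> - 1) / x K powr \<alpha>)"
    by (simp add: distrib_left add_divide_distrib mult_ac)
  also have "x K powr (\<alpha> - \<beta>) / x K powr \<alpha> = 1 / x K powr \<beta>"
    using x_pos[of K] by (simp add: powr_diff)
  also have "x K powr (\<alpha> - \<beta> - 1) / x K powr \<alpha> = 1 / x K powr (\<beta> + 1)"
    using x_pos[of K] by (simp add: powr_diff powr_add)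
  finally show "\<xi> K \<le>
             c * (k0 + 1) powr \<alpha> * \<xi> 0 / (k0 + real n * real K) powr \<alpha>
           + c * (k0 + real n + 1) powr \<alpha> * A1 / (k0 + real n * real K) powr \<alpha>
           + (c / (\<alpha> - \<beta>)) * exp (\<alpha> / (k0 + real n + 1)) * A2
               / (real n * (k0 + real n * real K) powr \<beta>)
           + c * exp (\<alpha> / (k0 + real n + 1)) * A2 / (k0 + real n * real K) powr (\<beta> + 1)"
    using main unfolding x_def[symmetric] M_def[symmetric]
    by (simp add: B_def distrib_left add_divide_distrib mult_ac)
qed

end
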